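(* Let $d\geq 1$ be real and let $\vec{X}=(X_1,\ldots,X_n)$ be an iid random vector whose entries satisfy $\mathbb{E}|X_1|^d<\infty$. Then $$\|A\|_{\vec{X},d}=\left(\frac{\mathbb{E}\,|\langle\vec{X},\boldsymbol{\lambda}(A)\rangle|^d}{\Gamma(d+1)}\right)^{1/d}$$ is a weakly unitarily invariant norm on $\mathrm{H}_n$. Moreover, if $m\geq 1$ and $\mathbb{E}|X_1|^m<\infty$, then for every $A\in\mathrm{H}_n$ the function $[1,m]\to\mathbb{R}$, $d\mapsto\|A\|_{\vec{X},d}$, is continuous.
   Context: An iid random vector is a random vector $\vec{X}=(X_1,\ldots,X_n)$ in $\mathbb{R}^n$ whose entries are independent, identically distributed, nondegenerate (not almost surely constant) real random variables. $\langle\cdot,\cdot\rangle$ is the standard inner product on $\mathbb{R}^n$ and $\Gamma$ is the gamma function. $\mathrm{H}_n$ is the real vector space of $n\times n$ complex Hermitian matrices; for $A\in\mathrm{H}_n$, $\boldsymbol{\lambda}(A)=(\lambda_1,\ldots,\lambda_n)$ is the vector of eigenvalues of $A$ with $\lambda_1\geq\cdots\geq\lambda_n$. A norm $\|\cdot\|$ on $\mathrm{H}_n$ is weakly unitarily invariant if $\|U^*AU\|=\|A\|$ for all $A\in\mathrm{H}_n$ and all unitary $U\in\mathrm{M}_n$. *)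

theory Defs
  imports "HOL-Probability.Probability" "Jordan_Normal_Form.Char_Poly"
    "Jordan_Normal_Form.Schur_Decomposition" "HOL-Computational_Algebra.Polynomial"
begin

definition hermitian_mats :: "nat \<Rightarrow> complex mat set" where
  "hermitian_mats n = {A. A \<in> carrier_mat n n \<and> mat_adjoint A = A}"

definition unitary_mat :: "nat \<Rightarrow> complex mat \<Rightarrow> bool" where
  "unitary_mat n U \<longleftrightarrow> U \<in> carrier_mat n n \<and> mat_adjoint U * U = 1\<^sub>m n"

text \<open>Eigenvalues (with multiplicity) of a Hermitian matrix, listed in
  non-increasing order: lambda_1 >= ... >= lambda_n (the roots of the
  characteristic polynomial, which are real for Hermitian matrices).\<close>
definition eigvals_desc :: "complex mat \<Rightarrow> real list" where
  "eigvals_desc A = rev (sorted_list_of_multiset (image_mset Re (proots (char_poly A))))"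

definition iid_random_vector :: "'a measure \<Rightarrow> nat \<Rightarrow> (nat \<Rightarrow> 'a \<Rightarrow> real) \<Rightarrow> bool" where
  "iid_random_vector M n X \<longleftrightarrow>
     (\<forall>i<n. X i \<in> borel_measurable M) \<and>
     prob_space.indep_vars M (\<lambda>_. borel) X {..<n} \<and>
     (\<forall>i<n. distr M borel (X i) = distr M borel (X 0)) \<and>
     (\<forall>i<n. \<forall>c. \<not> (AE \<omega> in M. X i \<omega> = c))"

definition rv_norm :: "'a measure \<Rightarrow> nat \<Rightarrow> (nat \<Rightarrow> 'a \<Rightarrow> real) \<Rightarrow> real \<Rightarrow> complex mat \<Rightarrow> real" where
  "rv_norm M n X d A =
     ((integral\<^sup>L M (\<lambda>\<omega>. \<bar>\<Sum>i<n. X i \<omega> * eigvals_desc A ! i\<bar> powr d)) / Gamma (d + 1)) powr (1 / d)"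

definition is_norm_on_hermitian :: "nat \<Rightarrow> (complex mat \<Rightarrow> real) \<Rightarrow> bool" where
  "is_norm_on_hermitian n N \<longleftrightarrow>
     (\<forall>A\<in>hermitian_mats n. 0 \<le> N A) \<and>
     (\<forall>A\<in>hermitian_mats n. N A = 0 \<longleftrightarrow> A = 0\<^sub>m n n) \<and>
     (\<forall>A\<in>hermitian_mats n. \<forall>c::real. N (complex_of_real c \<cdot>\<^sub>m A) = \<bar>c\<bar> * N A) \<and>
     (\<forall>A\<in>hermitian_mats n. \<forall>B\<in>hermitian_mats n. N (A + B) \<le> N A + N B)"

definition weakly_unitarily_invariant :: "nat \<Rightarrow> (complex mat \<Rightarrow> real) \<Rightarrow> bool" where
  "weakly_unitarily_invariant n N \<longleftrightarrow>
     (\<forall>A\<in>hermitian_mats n. \<forall>U. unitary_mat n U \<longrightarrow> N (mat_adjoint U * A * U) = N A)"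

end

(* In an eigenbasis of A + B the diagonals of A and B are doubly stochastic images of their
   spectra.  By exchangeability of X the functional x |-> E|<X, x>|^d is symmetric, and by convexity
   it does not increase under doubly stochastic matrices; together with Minkowski's inequality on
   R^n this gives the triangle inequality.  Definiteness: if <X, x> = 0 a.s. with some x_k nonzero,
   then X_k is a.s. a function of the other entries, hence independent of itself, hence constant. *)

theory Submission
  imports Defs
begin

section \<open>Spectra of Hermitian matrices\<close>

text \<open>The sorted spectrum is not additive in the matrix, and a negative scalar reverses its
  order. Spectra are therefore compared as multisets: any diagonalization serves, with its
  eigenvalues in whatever order, since the order is erased once a symmetric functional is applied.
  The entries of X are only assumed to have a finite absolute moment of order d, where d may be as
  small as 1. Hence self-independence is tested on the bounded injective transform
  \<open>arctan\<close> rather than on variances of X; convexity enters through a subgradient, as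
  the absolute value has a kink at 0 when d = 1; and products of this subgradient with an entry of X
  need their own integrability bound. For fixed d, division by Gamma(d + 1) only rescales by a
  positive constant. When d varies, continuity also needs a nonzero base under the d-th root, so an
  almost surely vanishing linear form is a separate case.\<close>

lemma dim_mat_adjoint [simp]:
  "dim_row (mat_adjoint A) = dim_col A" "dim_col (mat_adjoint A) = dim_row A"
  by (simp_all add: mat_adjoint_def)

lemma mat_adjoint_carrier [simp]: "A \<in> carrier_mat n m \<Longrightarrow> mat_adjoint A \<in> carrier_mat m n"
  by auto

lemma index_mat_adjoint [simp]:
  "i < dim_col A \<Longrightarrow> j < dim_row A \<Longrightarrow> mat_adjoint A $$ (i, j) = conjugate (A $$ (j, i))"
  by (simp add: mat_adjoint_def mat_of_rows_index)

lemma mat_adjoint_adjoint [simp]: "mat_adjoint (mat_adjoint A) = A"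
  by (rule eq_matI) auto

text \<open>The inner dimension of \<open>mult_carrier_mat\<close> occurs only in its premises;
  fixing all dimensions to one \<open>n\<close> spares the simplifier from guessing it.\<close>

lemmas mult_square_mat [simp] = mult_carrier_mat[of _ n n _ n for n]

lemmas assoc_square_mat = assoc_mult_mat[of _ n n _ n _ n for n]

lemma mat_adjoint_mult:
  fixes A B :: "complex mat"
  assumes "A \<in> carrier_mat n m" "B \<in> carrier_mat m k"
  shows "mat_adjoint (A * B) = mat_adjoint B * mat_adjoint A"
  by (rule eq_matI) (use assms in \<open>auto simp: scalar_prod_def mult.commute\<close>)

lemma hermitian_mats_carrier: "A \<in> hermitian_mats n \<Longrightarrow> A \<in> carrier_mat n n"
  by (simp add: hermitian_mats_def)

lemma hermitian_mats_index:
  assumes "A \<in> hermitian_mats n" "i < n" "j < n"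
  shows "A $$ (j, i) = cnj (A $$ (i, j))"
proof -
  have "A $$ (j, i) = mat_adjoint A $$ (j, i)" "A \<in> carrier_mat n n"
    using assms by (simp_all add: hermitian_mats_def)
  then show ?thesis using assms(2,3) by simp
qed

lemma hermitian_matsI:
  assumes A: "A \<in> carrier_mat n n"
    and eq: "\<And>i j. i < n \<Longrightarrow> j < n \<Longrightarrow> A $$ (j, i) = cnj (A $$ (i, j))"
  shows "A \<in> hermitian_mats n"
proof -
  have "mat_adjoint A $$ (i, j) = A $$ (i, j)" if "i < n" "j < n" for i j
    using A that by (subst eq[OF that(2,1)]) simp
  then have "mat_adjoint A = A" using A by (intro eq_matI) auto
  with A show ?thesis by (simp add: hermitian_mats_def)
qed

lemma hermitian_mats_add:
  assumes A: "A \<in> hermitian_mats n" and B: "B \<in> hermitian_mats n"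
  shows "A + B \<in> hermitian_mats n"
proof (rule hermitian_matsI)
  show "(A + B) $$ (j, i) = cnj ((A + B) $$ (i, j))" if "i < n" "j < n" for i j
    using that A[THEN hermitian_mats_carrier] B[THEN hermitian_mats_carrier]
    by (simp add: hermitian_mats_index[OF A that] hermitian_mats_index[OF B that])
qed (use assms[THEN hermitian_mats_carrier] in auto)

lemma unitary_mat_carrier: "unitary_mat n U \<Longrightarrow> U \<in> carrier_mat n n"
  by (simp add: unitary_mat_def)

lemma unitary_mat_inverse:
  assumes "unitary_mat n U"
  shows "mat_adjoint U * U = 1\<^sub>m n" "U * mat_adjoint U = 1\<^sub>m n"
  using assms mat_mult_left_right_inverse[of "mat_adjoint U" n U] by (auto simp: unitary_mat_def)

lemma unitary_mat_adjoint: "unitary_mat n U \<Longrightarrow> unitary_mat n (mat_adjoint U)"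
  using unitary_mat_inverse[of n U] by (auto simp: unitary_mat_def)

lemma unitary_mat_mult:
  assumes "unitary_mat n U" "unitary_mat n V"
  shows "unitary_mat n (U * V)"
proof -
  note c = assms[THEN unitary_mat_carrier]
  have "mat_adjoint (U * V) * (U * V) = mat_adjoint V * ((mat_adjoint U * U) * V)"
    using c by (simp add: mat_adjoint_mult[of _ n n _ n] assoc_square_mat[of _ n])
  also have "\<dots> = 1\<^sub>m n"
    using assms c by (simp add: unitary_mat_inverse)
  finally show ?thesis using c by (simp add: unitary_mat_def)
qed

lemma hermitian_mats_conj:
  assumes "A \<in> hermitian_mats n" "U \<in> carrier_mat n n"
  shows "mat_adjoint U * A * U \<in> hermitian_mats n"
proof -
  have "A \<in> carrier_mat n n" "mat_adjoint A = A" using assms by (simp_all add: hermitian_mats_def)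
  then have "mat_adjoint (mat_adjoint U * A * U) = mat_adjoint U * A * U"
    using assms(2) by (simp add: mat_adjoint_mult[of _ n n _ n] assoc_square_mat[of _ n])
  moreover have "mat_adjoint U * A * U \<in> carrier_mat n n"
    using \<open>A \<in> carrier_mat n n\<close> assms(2) by (metis mat_adjoint_carrier mult_carrier_mat)
  ultimately show ?thesis by (simp add: hermitian_mats_def)
qed

section \<open>The spectral theorem by deflation\<close>

text \<open>The characteristic polynomial splits over the complex numbers, so an eigenvector exists.
  Completed to a basis and orthonormalized, it becomes the first column of \<open>U\<close>, which
  \<open>A\<close> then scales by \<open>e\<close>. This is the deflation step of the induction
  below.\<close>

lemma unitary_extending_eigenvector:
  fixes A :: "complex mat"
  assumes A: "A \<in> carrier_mat (Suc m) (Suc m)"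
  obtains U e where "unitary_mat (Suc m) U"
    "\<And>i. i < Suc m \<Longrightarrow> (mat_adjoint U * A * U) $$ (i, 0) = (if i = 0 then e else 0)"
proof -
  let ?n = "Suc m"
  obtain es where es: "char_poly A = (\<Prod>a\<leftarrow>es. [:- a, 1:])" "length es = ?n"
    using char_poly_factorized[OF A] by auto
  then obtain e es' where "es = e # es'" by (cases es) auto
  with es have "poly (char_poly A) e = 0" by simp
  then have "eigenvalue A e" by (simp add: eigenvalue_root_char_poly[OF A])
  then obtain v where "eigenvector A v e" by (auto simp: eigenvalue_def)
  then have v: "v \<in> carrier_vec ?n" "v \<noteq> 0\<^sub>v ?n" and Av: "A *\<^sub>v v = e \<cdot>\<^sub>v v"
    using A by (auto simp: eigenvector_def)
  interpret cof_vec_space ?n "TYPE(complex)" .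
  define b where "b = basis_completion v"
  note bc = basis_completion[OF v, folded b_def]
  define ws where "ws = gram_schmidt ?n b"
  note gs = gram_schmidt_result[OF bc(2,4,5) ws_def]
  have len: "length ws = ?n" using gs bc by simp
  have wsc: "ws ! i \<in> carrier_vec ?n" if "i < ?n" for i using gs that len by (simp add: subset_code(1))
  obtain vs where bv: "b = v # vs" using bc(6,7) by (cases b) auto
  \<comment> \<open>Gram-Schmidt leaves the first vector unchanged, so the eigenvector survives as
    \<open>ws ! 0\<close>.\<close>
  have "hd ws = v" unfolding ws_def bv using gram_schmidt_hd[OF v(1)] .
  then have ws0: "ws ! 0 = v" using len by (metis hd_conv_nth list.size(3) nat.distinct(1))
  \<comment> \<open>The vectors \<open>ws\<close> are orthogonal but not normalized;
    \<open>q i\<close> is the length by which column \<open>i\<close> of \<open>U\<close> is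
    divided.\<close>
  define q where "q i = sqrt (Re (ws ! i \<bullet>c ws ! i))" for i
  have orth: "(ws ! i \<bullet>c ws ! j = 0) = (i \<noteq> j)" if "i < ?n" "j < ?n" for i j
    using corthogonalD[OF gs(2)] that len by simp
  have qpos: "q i > 0" "complex_of_real (q i) * complex_of_real (q i) = ws ! i \<bullet>c ws ! i" if "i < ?n" for i
  proof -
    have "ws ! i \<bullet>c ws ! i \<noteq> 0" using orth[of i i] that by simp
    moreover have "ws ! i \<bullet>c ws ! i \<ge> 0" by blast
    ultimately have "Re (ws ! i \<bullet>c ws ! i) > 0" "Im (ws ! i \<bullet>c ws ! i) = 0"
      by (auto simp: less_eq_complex_def complex_eq_iff order_less_le)
    then show "q i > 0" "complex_of_real (q i) * complex_of_real (q i) = ws ! i \<bullet>c ws ! i"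
      by (auto simp: q_def complex_eq_iff)
  qed
  define U where "U = Matrix.mat ?n ?n (\<lambda>(i, j). ws ! j $ i / complex_of_real (q j))"
  have Uc: "U \<in> carrier_mat ?n ?n" by (simp add: U_def)
  have UU: "mat_adjoint U * U = 1\<^sub>m ?n"
  proof (rule eq_matI)
    fix i j assume "i < dim_row (1\<^sub>m ?n)" "j < dim_col (1\<^sub>m ?n)"
    then have ij: "i < ?n" "j < ?n" by auto
    have "(mat_adjoint U * U) $$ (i, j)
        = (\<Sum>k<?n. cnj (ws ! i $ k / complex_of_real (q i)) * (ws ! j $ k / complex_of_real (q j)))"
      using ij Uc by (simp add: scalar_prod_def U_def atLeast0LessThan del: sum.lessThan_Suc)
    also have "\<dots> = (\<Sum>k<?n. ws ! j $ k * cnj (ws ! i $ k)) / (complex_of_real (q i) * complex_of_real (q j))"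
      by (simp add: sum_divide_distrib mult.commute del: sum.lessThan_Suc)
    also have "(\<Sum>k<?n. ws ! j $ k * cnj (ws ! i $ k)) = ws ! j \<bullet>c ws ! i"
      using wsc[OF ij(1)] wsc[OF ij(2)] by (auto simp: scalar_prod_def atLeast0LessThan intro!: sum.cong)
    also have "(ws ! j \<bullet>c ws ! i) / (complex_of_real (q i) * complex_of_real (q j)) = 1\<^sub>m ?n $$ (i, j)"
      using orth[OF ij(2,1)] ij qpos[OF ij(1)] by auto
    finally show "(mat_adjoint U * U) $$ (i, j) = 1\<^sub>m ?n $$ (i, j)" .
  qed (use Uc in auto)
  have unU: "unitary_mat ?n U" using Uc UU by (simp add: unitary_mat_def)
  have AU: "col (A * U) 0 = e \<cdot>\<^sub>v col U 0"
  proof -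
    have "col U 0 = (1 / complex_of_real (q 0)) \<cdot>\<^sub>v v"
      using v by (auto simp: U_def ws0 intro!: eq_vecI)
    moreover have "col (A * U) 0 = A *\<^sub>v col U 0" using col_mult2[OF A Uc] by simp
    ultimately show ?thesis using mult_mat_vec[OF A v(1)] Av
      by (simp add: smult_smult_assoc mult.commute)
  qed
  have "(mat_adjoint U * A * U) $$ (i, 0) = (if i = 0 then e else 0)" if i: "i < ?n" for i
  proof -
    have "(mat_adjoint U * A * U) $$ (i, 0) = (mat_adjoint U * (A * U)) $$ (i, 0)"
      using A Uc by (simp add: assoc_square_mat[of _ ?n])
    also have "\<dots> = row (mat_adjoint U) i \<bullet> col (A * U) 0"
      using i A Uc by (subst index_mult_mat) auto
    also have "\<dots> = e * (row (mat_adjoint U) i \<bullet> col U 0)"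
      using Uc i by (simp add: AU)
    also have "row (mat_adjoint U) i \<bullet> col U 0 = (mat_adjoint U * U) $$ (i, 0)"
      using i Uc by (subst index_mult_mat) auto
    finally show ?thesis using i UU by simp
  qed
  with unU show thesis by (rule that)
qed

lemma hermitian_diagonalization:
  assumes "A \<in> hermitian_mats n"
  obtains U l where "unitary_mat n U" "mat_adjoint U * A * U = mat_diag n (\<lambda>i. complex_of_real (l i))"
proof -
  have "\<exists>U l. unitary_mat n U \<and> mat_adjoint U * A * U = mat_diag n (\<lambda>i. complex_of_real (l i))"
    using assms
  proof (induction n arbitrary: A)
    case 0
    \<comment> \<open>In dimension 0 the matrix \<open>A\<close> itself can be taken as the
      unitary.\<close>
    then have "unitary_mat 0 A" "mat_adjoint A * A * A = mat_diag 0 (\<lambda>i. complex_of_real (i :: real))"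
      by (auto simp: unitary_mat_def hermitian_mats_def mat_diag_def intro!: eq_matI)
    then show ?case by (metis (no_types, lifting) mat_diag_dim eq_matI carrier_matD less_nat_zero_code
      index_mult_mat(2,3) dim_mat_adjoint(1) unitary_mat_carrier)
  next
    case (Suc m A)
    let ?n = "Suc m"
    have A: "A \<in> carrier_mat ?n ?n" using Suc.prems by (rule hermitian_mats_carrier)
    obtain U1 e where U1: "unitary_mat ?n U1"
      and col0: "\<And>i. i < ?n \<Longrightarrow> (mat_adjoint U1 * A * U1) $$ (i, 0) = (if i = 0 then e else 0)"
      using unitary_extending_eigenvector[OF A] by metis
    define B where "B = mat_adjoint U1 * A * U1"
    have B: "B \<in> hermitian_mats ?n"
      unfolding B_def using Suc.prems U1 by (simp add: hermitian_mats_conj unitary_mat_carrier)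
    note Bc = hermitian_mats_carrier[OF B]
    define C where "C = Matrix.mat m m (\<lambda>(i, j). B $$ (Suc i, Suc j))"
    have C: "C \<in> hermitian_mats m"
      by (rule hermitian_matsI) (auto simp: C_def intro!: hermitian_mats_index[OF B])
    note Cc = hermitian_mats_carrier[OF C]
    obtain U3 l where U3: "unitary_mat m U3" and l: "mat_adjoint U3 * C * U3 = mat_diag m (\<lambda>i. complex_of_real (l i))"
      using Suc.IH[OF C] by auto
    note U3c = unitary_mat_carrier[OF U3]
    note Bi = hermitian_mats_index[OF B]
    \<comment> \<open>Diagonal entries of a Hermitian matrix equal their own conjugates, so the
      eigenvalue is real.\<close>
    have "cnj e = e" using col0[of 0] Bi[of 0 0] by (simp add: B_def)
    then have e: "e = complex_of_real (Re e)" by (simp add: complex_eq_iff)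
    let ?E = "Matrix.mat 1 1 (\<lambda>_. e)"
    \<comment> \<open>Deflation clears column 0 below the corner; Hermitian symmetry then clears row
      0, so the induction hypothesis applies to the remaining block \<open>C\<close>.\<close>
    have Bblock: "B = four_block_mat ?E (0\<^sub>m 1 m) (0\<^sub>m m 1) C"
    proof (rule eq_matI, goal_cases)
      case (1 i j)
      then show ?case using col0[of i, folded B_def] col0[of j, folded B_def] Bi[of 0 j]  Bi[of j 0]
        by (cases i; cases j) (auto simp: C_def)
    qed (use Bc Cc in auto)
    define U2 where "U2 = four_block_mat (1\<^sub>m 1) (0\<^sub>m 1 m) (0\<^sub>m m 1) U3"
    have U2c: "U2 \<in> carrier_mat ?n ?n"
      unfolding U2_def using U3c by (metis four_block_carrier_mat one_carrier_mat plus_1_eq_Suc)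
    have U2a: "mat_adjoint U2 = four_block_mat (1\<^sub>m 1) (0\<^sub>m 1 m) (0\<^sub>m m 1) (mat_adjoint U3)"
      by (rule eq_matI) (use U3c in \<open>auto simp: U2_def\<close>)
    have U2: "unitary_mat ?n U2"
    proof -
      have "mat_adjoint U2 * U2 = four_block_mat (1\<^sub>m 1) (0\<^sub>m 1 m) (0\<^sub>m m 1) (1\<^sub>m m)"
        unfolding U2a unfolding U2_def using U3c
        by (subst mult_four_block_mat[of _ 1 1 _ m _ m _ _ 1 _ m]) (auto simp: unitary_mat_inverse[OF U3])
      then show ?thesis using U2c by (simp add: unitary_mat_def)
    qed
    have zero: "0\<^sub>m m m + mat_adjoint U3 * C = mat_adjoint U3 * C"
      "0\<^sub>m m m + mat_adjoint U3 * C * U3 = mat_adjoint U3 * C * U3"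
      using U3c Cc by (metis left_add_zero_mat mat_adjoint_carrier mult_carrier_mat)+
    have "mat_adjoint U2 * B * U2 = four_block_mat ?E (0\<^sub>m 1 m) (0\<^sub>m m 1) (mat_adjoint U3 * C * U3)"
      unfolding U2a unfolding U2_def Bblock using U3c Cc
      by (subst mult_four_block_mat[of _ 1 1 _ m _ m _ _ 1 _ m], simp_all,
          subst mult_four_block_mat[of _ 1 1 _ m _ m _ _ 1 _ m]) (auto simp: zero)
    also have "\<dots> = mat_diag ?n (\<lambda>i. complex_of_real (case i of 0 \<Rightarrow> Re e | Suc k \<Rightarrow> l k))"
      unfolding l
      by (rule eq_matI) (use e in \<open>auto simp: mat_diag_def split: nat.splits\<close>)
    finally have *: "mat_adjoint U2 * B * U2 = \<dots>" .
    have "mat_adjoint (U1 * U2) * A * (U1 * U2) = mat_adjoint U2 * B * U2"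
      unfolding B_def using A U1[THEN unitary_mat_carrier] U2c
      by (simp add: mat_adjoint_mult[of _ ?n ?n _ ?n] assoc_square_mat[of _ ?n])
    with * unitary_mat_mult[OF U1 U2] show ?case by metis
  qed
  with that show thesis by blast
qed


section \<open>Spectra as multisets\<close>

lemma proots_prod_linear_factors:
  fixes es :: "complex list"
  shows "proots (\<Prod>a\<leftarrow>es. [:- a, 1:]) = mset es"
proof (induction es)
  case (Cons a es)
  have "proots ([:- a, 1:] * (\<Prod>a\<leftarrow>es. [:- a, 1:])) = proots [:- a, 1:] + proots (\<Prod>a\<leftarrow>es. [:- a, 1:])"
    by (rule proots_mult) (auto simp: prod_list_zero_iff)
  then show ?case using Cons.IH by (simp only: list.map prod_list.Cons proots_linear_factor) simp
qed simp

text \<open>Similar matrices share the characteristic polynomial, and that of a diagonal matrix is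
  visibly a product of linear factors. This is the bridge from the sorted list to the unordered
  eigenvalues \<open>l\<close> of any diagonalization.\<close>

lemma mset_eigvals_desc:
  assumes A: "A \<in> carrier_mat n n" and U: "unitary_mat n U"
    and diag: "mat_adjoint U * A * U = mat_diag n (\<lambda>i. complex_of_real (l i))"
  shows "mset (eigvals_desc A) = mset (map l [0..<n])"
proof -
  let ?D = "mat_diag n (\<lambda>i. complex_of_real (l i))"
  have Uc: "U \<in> carrier_mat n n" using U by (rule unitary_mat_carrier)
  have "similar_mat_wit ?D A (mat_adjoint U) U"
    by (rule similar_mat_witI[of _ _ n]) (use A Uc diag unitary_mat_inverse[OF U] in auto)
  then have "char_poly A = char_poly ?D"
    using char_poly_similar[of ?D A] unfolding similar_mat_def by metis
  also have "\<dots> = (\<Prod>a\<leftarrow>diag_mat ?D. [:- a, 1:])"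
    by (rule char_poly_upper_triangular[of _ n]) (auto simp: mat_diag_def)
  also have "diag_mat ?D = map (\<lambda>i. complex_of_real (l i)) [0..<n]"
    by (auto simp: diag_mat_def mat_diag_def)
  finally have "proots (char_poly A) = mset (map (\<lambda>i. complex_of_real (l i)) [0..<n])"
    by (simp only: proots_prod_linear_factors)
  then show ?thesis by (simp add: eigvals_desc_def multiset.map_comp comp_def)
qed

text \<open>The sorted list is a function of the characteristic polynomial alone, so similarity
  preserves the list itself and not just its multiset.\<close>

lemma eigvals_desc_unitary_conj:
  assumes A: "A \<in> carrier_mat n n" and U: "unitary_mat n U"
  shows "eigvals_desc (mat_adjoint U * A * U) = eigvals_desc A"
proof -
  have "similar_mat_wit (mat_adjoint U * A * U) A (mat_adjoint U) U"
    by (rule similar_mat_witI[of _ _ n])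
      (use A unitary_mat_carrier[OF U] unitary_mat_inverse[OF U] in auto)
  then have "char_poly (mat_adjoint U * A * U) = char_poly A"
    using char_poly_similar unfolding similar_mat_def by metis
  then show ?thesis by (simp add: eigvals_desc_def)
qed

definition doubly_stochastic :: "nat \<Rightarrow> (nat \<Rightarrow> nat \<Rightarrow> real) \<Rightarrow> bool" where
  "doubly_stochastic n S \<longleftrightarrow> (\<forall>i<n. \<forall>j<n. 0 \<le> S i j)
     \<and> (\<forall>i<n. (\<Sum>j<n. S i j) = 1) \<and> (\<forall>j<n. (\<Sum>i<n. S i j) = 1)"

lemma unitary_mat_col_norm:
  assumes U: "unitary_mat n U" and j: "j < n"
  shows "(\<Sum>i<n. (cmod (U $$ (i, j)))\<^sup>2) = 1"
proof -
  have "complex_of_real (\<Sum>i<n. (cmod (U $$ (i, j)))\<^sup>2) = (mat_adjoint U * U) $$ (j, j)"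
    using unitary_mat_carrier[OF U] j
    by (auto simp: scalar_prod_def atLeast0LessThan complex_norm_square[symmetric] mult.commute intro!: sum.cong)
  also have "\<dots> = 1" using j by (simp add: unitary_mat_inverse[OF U])
  finally show ?thesis using of_real_eq_1_iff by blast
qed

text \<open>Columns of \<open>U\<close> are unit vectors, and so are its rows because the adjoint is
  unitary too. The indices are transposed to match the diagonal of a conjugate with the adjoint on
  the left.\<close>

lemma unitary_mat_doubly_stochastic:
  assumes U: "unitary_mat n U"
  shows "doubly_stochastic n (\<lambda>i j. (cmod (U $$ (j, i)))\<^sup>2)"
  using unitary_mat_col_norm[OF U] unitary_mat_col_norm[OF unitary_mat_adjoint[OF U]]
    unitary_mat_carrier[OF U]
  by (simp add: doubly_stochastic_def)

text \<open>With \<open>W\<close> the change of basis from the eigenbasis \<open>V\<close> to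
  \<open>U\<close>, conjugating \<open>A\<close> by \<open>U\<close> is conjugating its diagonal
  form by \<open>W\<close>; the diagonal entries then average the eigenvalues with weights the
  squared moduli of the entries of \<open>W\<close>.\<close>

lemma diagonal_doubly_stochastic:
  assumes A: "A \<in> carrier_mat n n" and V: "unitary_mat n V"
    and diag: "mat_adjoint V * A * V = mat_diag n (\<lambda>i. complex_of_real (l i))"
    and U: "unitary_mat n U"
  obtains S where "doubly_stochastic n S"
    "\<And>i. i < n \<Longrightarrow> (mat_adjoint U * A * U) $$ (i, i) = complex_of_real (\<Sum>j<n. S i j * l j)"
proof -
  note Vc = unitary_mat_carrier[OF V] and Uc = unitary_mat_carrier[OF U]
  let ?D = "mat_diag n (\<lambda>i. complex_of_real (l i))"
  define W where "W = mat_adjoint V * U"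
  have W: "unitary_mat n W"
    unfolding W_def using U V by (simp add: unitary_mat_mult unitary_mat_adjoint)
  note Wc = unitary_mat_carrier[OF W]
  have id: "V * (mat_adjoint V * B) = B" if "B \<in> carrier_mat n n" for B
    using that Vc assoc_mult_mat[of V n n "mat_adjoint V" n B n] by (simp add: unitary_mat_inverse[OF V])
  have "mat_adjoint W * ?D * W = mat_adjoint U * A * U"
    unfolding diag[symmetric] W_def using A Vc Uc
    by (simp add: mat_adjoint_mult[of _ n n _ n] assoc_square_mat[of _ n] id)
  moreover have "(mat_adjoint W * ?D * W) $$ (i, i)
      = complex_of_real (\<Sum>j<n. (cmod (W $$ (j, i)))\<^sup>2 * l j)" if i: "i < n" for i
  proof -
    have "mat_adjoint W * ?D = Matrix.mat n n (\<lambda>(i, j). cnj (W $$ (j, i)) * complex_of_real (l j))"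
      using Wc by (subst mat_diag_mult_right[of _ n]) (auto intro!: eq_matI)
    then have "(mat_adjoint W * ?D * W) $$ (i, i)
        = (\<Sum>j<n. cnj (W $$ (j, i)) * complex_of_real (l j) * W $$ (j, i))"
      using Wc i by (auto simp: scalar_prod_def atLeast0LessThan)
    also have "\<dots> = complex_of_real (\<Sum>j<n. (cmod (W $$ (j, i)))\<^sup>2 * l j)"
      by (auto simp: complex_norm_square[symmetric] algebra_simps intro!: sum.cong)
    finally show ?thesis .
  qed
  ultimately show thesis using that[OF unitary_mat_doubly_stochastic[OF W]] by simp
qed

text \<open>Stated for multisets because a negative \<open>c\<close> reverses the sorted
  order.\<close>

lemma eigvals_desc_smult:
  assumes A: "A \<in> hermitian_mats n"
  shows "mset (eigvals_desc (complex_of_real c \<cdot>\<^sub>m A)) = mset (map ((*) c) (eigvals_desc A))"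
proof -
  obtain U l where U: "unitary_mat n U"
    and diag: "mat_adjoint U * A * U = mat_diag n (\<lambda>i. complex_of_real (l i))"
    using hermitian_diagonalization[OF A] .
  note Ac = hermitian_mats_carrier[OF A] and Uc = unitary_mat_carrier[OF U]
  have "mat_adjoint U * (complex_of_real c \<cdot>\<^sub>m A) * U = complex_of_real c \<cdot>\<^sub>m (mat_adjoint U * A * U)"
    using Ac Uc by (simp add: mult_smult_distrib[of _ n n _ n] mult_smult_assoc_mat[of _ n n _ n] mult_square_mat[of _ n])
  also have "\<dots> = mat_diag n (\<lambda>i. complex_of_real (c * l i))"
    unfolding diag by (auto simp: mat_diag_def intro!: eq_matI)
  finally have "mset (eigvals_desc (complex_of_real c \<cdot>\<^sub>m A)) = mset (map (\<lambda>i. c * l i) [0..<n])"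
    using Ac U by (intro mset_eigvals_desc) auto
  also have "\<dots> = image_mset ((*) c) (mset (eigvals_desc A))"
    unfolding mset_eigvals_desc[OF Ac U diag] by (simp add: multiset.map_comp comp_def)
  finally show ?thesis by simp
qed

lemma length_eigvals_desc:
  assumes "A \<in> hermitian_mats n"
  shows "length (eigvals_desc A) = n"
proof -
  obtain U l where "unitary_mat n U"
    and "mat_adjoint U * A * U = mat_diag n (\<lambda>i. complex_of_real (l i))"
    using hermitian_diagonalization[OF assms] .
  from mset_eigvals_desc[OF hermitian_mats_carrier[OF assms] this] show ?thesis
    by (metis length_map length_upt minus_nat.diff_0 size_mset)
qed

text \<open>Vanishing spectrum forces the diagonal form to vanish, and the unitary conjugation can
  be undone; nilpotent matrices show that diagonalizability is essential.\<close>

lemma hermitian_eq_0_iff: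
  assumes A: "A \<in> hermitian_mats n"
  shows "A = 0\<^sub>m n n \<longleftrightarrow> (\<forall>i<n. eigvals_desc A ! i = 0)"
proof -
  obtain U l where U: "unitary_mat n U"
    and diag: "mat_adjoint U * A * U = mat_diag n (\<lambda>i. complex_of_real (l i))"
    using hermitian_diagonalization[OF A] .
  note Ac = hermitian_mats_carrier[OF A] and Uc = unitary_mat_carrier[OF U]
  have "mat_adjoint U * A * U = 0\<^sub>m n n \<longleftrightarrow> A = 0\<^sub>m n n"
  proof
    assume *: "mat_adjoint U * A * U = 0\<^sub>m n n"
    have "A = (U * mat_adjoint U) * A * (U * mat_adjoint U)"
      using Ac by (simp add: unitary_mat_inverse[OF U])
    also have "\<dots> = U * (mat_adjoint U * A * U) * mat_adjoint U"
      using Ac Uc by (simp add: assoc_square_mat[of _ n])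
    finally show "A = 0\<^sub>m n n" unfolding * using Uc by simp
  qed (use Uc in simp)
  moreover have "mat_adjoint U * A * U = 0\<^sub>m n n \<longleftrightarrow> (\<forall>i<n. l i = 0)"
    unfolding diag by (auto simp: mat_diag_def mat_eq_iff)
  moreover have "(\<forall>i<n. l i = 0) \<longleftrightarrow> (\<forall>x\<in>#mset (eigvals_desc A). x = 0)"
    unfolding mset_eigvals_desc[OF Ac U diag] by auto
  moreover have "\<dots> \<longleftrightarrow> (\<forall>i<n. eigvals_desc A ! i = 0)"
    using length_eigvals_desc[OF A] by (simp add: all_set_conv_all_nth)
  ultimately show ?thesis by simp
qed

lemma eigvals_desc_add:
  assumes A: "A \<in> hermitian_mats n" and B: "B \<in> hermitian_mats n"
  obtains S T a b where "doubly_stochastic n S" "doubly_stochastic n T"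
    "mset (eigvals_desc A) = mset (map a [0..<n])" "mset (eigvals_desc B) = mset (map b [0..<n])"
    "mset (eigvals_desc (A + B)) = mset (map (\<lambda>i. (\<Sum>j<n. S i j * a j) + (\<Sum>j<n. T i j * b j)) [0..<n])"
proof -
  note Ac = hermitian_mats_carrier[OF A] and Bc = hermitian_mats_carrier[OF B]
  obtain V a where V: "unitary_mat n V"
    and a: "mat_adjoint V * A * V = mat_diag n (\<lambda>i. complex_of_real (a i))"
    using hermitian_diagonalization[OF A] .
  obtain W b where W: "unitary_mat n W"
    and b: "mat_adjoint W * B * W = mat_diag n (\<lambda>i. complex_of_real (b i))"
    using hermitian_diagonalization[OF B] .
  obtain U c where U: "unitary_mat n U"
    and c: "mat_adjoint U * (A + B) * U = mat_diag n (\<lambda>i. complex_of_real (c i))"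
    using hermitian_diagonalization[OF hermitian_mats_add[OF A B]] .
  note Uc = unitary_mat_carrier[OF U]
  obtain S where S: "doubly_stochastic n S"
    "\<And>i. i < n \<Longrightarrow> (mat_adjoint U * A * U) $$ (i, i) = complex_of_real (\<Sum>j<n. S i j * a j)"
    using diagonal_doubly_stochastic[OF Ac V a U] by blast
  obtain T where T: "doubly_stochastic n T"
    "\<And>i. i < n \<Longrightarrow> (mat_adjoint U * B * U) $$ (i, i) = complex_of_real (\<Sum>j<n. T i j * b j)"
    using diagonal_doubly_stochastic[OF Bc W b U] by blast
  have split: "mat_adjoint U * (A + B) * U = mat_adjoint U * A * U + mat_adjoint U * B * U"
    using Ac Bc Uc
    by (simp add: mult_add_distrib_mat[of _ n n _ n] add_mult_distrib_mat[of _ n n _ _ n] mult_square_mat[of _ n])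
  have "c i = (\<Sum>j<n. S i j * a j) + (\<Sum>j<n. T i j * b j)" if i: "i < n" for i
  proof -
    have "complex_of_real (c i) = (mat_adjoint U * (A + B) * U) $$ (i, i)"
      unfolding c using i by (simp add: mat_diag_def)
    also have "\<dots> = complex_of_real ((\<Sum>j<n. S i j * a j) + (\<Sum>j<n. T i j * b j))"
      unfolding split using i Bc Uc S(2)[OF i] T(2)[OF i]
      by (subst index_add_mat) (simp_all del: index_mult_mat of_real_sum add: index_mult_mat(2,3))
    finally show ?thesis by (simp only: of_real_eq_iff)
  qed
  then have "map c [0..<n] = map (\<lambda>i. (\<Sum>j<n. S i j * a j) + (\<Sum>j<n. T i j * b j)) [0..<n]"
    by simp
  then show thesis
    using that[OF S(1) T(1) mset_eigvals_desc[OF Ac V a] mset_eigvals_desc[OF Bc W b]]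
      mset_eigvals_desc[OF add_carrier_mat[OF Bc] U c] by metis
qed

section \<open>Doubly stochastic matrices and convexity\<close>

text \<open>Averaging a decreasing vector lowers its partial sums and keeps its total, i.e.
  \<open>x\<close> majorizes its image; summation by parts against the decreasing weights
  \<open>g\<close> then gives the inequality.\<close>

lemma sum_doubly_stochastic_le:
  fixes g x :: "nat \<Rightarrow> real"
  assumes S: "doubly_stochastic n S"
    and g: "\<And>i j. i \<le> j \<Longrightarrow> j < n \<Longrightarrow> g j \<le> g i"
    and x: "\<And>i j. i \<le> j \<Longrightarrow> j < n \<Longrightarrow> x j \<le> x i"
  shows "(\<Sum>i<n. g i * (\<Sum>j<n. S i j * x j)) \<le> (\<Sum>i<n. g i * x i)"
proof (cases n)
  case (Suc m)
  define y where "y i = (\<Sum>j<n. S i j * x j)" for i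
  have partial: "(\<Sum>i<k. y i) \<le> (\<Sum>i<k. x i)" if k: "k < n" for k
  proof -
    \<comment> \<open>The weight which the first \<open>k\<close> rows put on column
      \<open>j\<close>: it lies in [0, 1], and the total is \<open>k\<close>.\<close>
    define c where "c j = (\<Sum>i<k. S i j)" for j
    have c: "0 \<le> c j" "c j \<le> 1" if "j < n" for j
    proof -
      show "0 \<le> c j" using S that k by (auto simp: c_def doubly_stochastic_def intro!: sum_nonneg)
      have "c j \<le> (\<Sum>i<n. S i j)"
        unfolding c_def using S that k by (intro sum_mono2) (auto simp: doubly_stochastic_def)
      then show "c j \<le> 1" using S that by (simp add: doubly_stochastic_def)
    qed
    have "(\<Sum>j<n. c j) = (\<Sum>i<k. \<Sum>j<n. S i j)"
      unfolding c_def by (rule sum.swap)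
    also have "\<dots> = real k" using S k by (simp add: doubly_stochastic_def)
    finally have csum: "(\<Sum>j<n. c j) = real k" .
    have ind: "(\<Sum>j<n. (if j < k then 1 else 0) * f j) = (\<Sum>j<k. f j)" for f :: "nat \<Rightarrow> real"
      using k by (intro sum.mono_neutral_cong_right) auto
    have "(\<Sum>i<k. y i) = (\<Sum>j<n. c j * x j)"
      unfolding y_def c_def by (subst sum.swap) (simp add: sum_distrib_right)
    \<comment> \<open>Both families of weights sum to \<open>k\<close>, so subtracting the pivot
      \<open>x k\<close> costs nothing. It makes every term nonnegative: both factors are
      nonnegative for \<open>j < k\<close> and nonpositive otherwise.\<close>
    moreover have "0 \<le> (\<Sum>j<n. ((if j < k then 1 else 0) - c j) * (x j - x k))"
    proof (rule sum_nonneg)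
      fix j assume "j \<in> {..<n}"
      then show "0 \<le> ((if j < k then 1 else 0) - c j) * (x j - x k)"
        using c[of j] x[of j k] x[of k j] k
        by (cases "j < k") (auto intro!: mult_nonneg_nonneg mult_nonneg_nonpos)
    qed
    moreover have "(\<Sum>j<n. ((if j < k then 1 else 0) - c j) * (x j - x k))
        = (\<Sum>j<n. (if j < k then 1 else 0) * x j) - (\<Sum>j<n. c j * x j)
          - ((\<Sum>j<n. (if j < k then 1 else 0) * 1) - (\<Sum>j<n. c j)) * x k"
      by (simp add: algebra_simps sum.distrib sum_subtractf sum_distrib_left sum_distrib_right)
    ultimately show ?thesis unfolding ind csum by simp
  qed
  have total: "(\<Sum>i<n. y i) = (\<Sum>i<n. x i)"
  proof -
    have "(\<Sum>i<n. y i) = (\<Sum>j<n. (\<Sum>i<n. S i j) * x j)"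
      unfolding y_def by (subst sum.swap) (simp add: sum_distrib_right)
    then show ?thesis using S by (simp add: doubly_stochastic_def)
  qed
  define D where "D k = (\<Sum>i<k. x i - y i)" for k
  \<comment> \<open>Summation by parts. For \<open>k = m\<close>, with \<open>n = Suc m\<close>, the
    boundary term vanishes because the totals agree.\<close>
  have abel: "(\<Sum>i<Suc k. g i * (x i - y i)) = g k * D (Suc k) + (\<Sum>i<k. (g i - g (Suc i)) * D (Suc i))" for k
    by (induction k) (auto simp: D_def algebra_simps)
  have "0 \<le> (\<Sum>i<m. (g i - g (Suc i)) * D (Suc i))"
    using g Suc partial
    by (intro sum_nonneg mult_nonneg_nonneg) (auto simp: D_def sum_subtractf simp del: sum.lessThan_Suc)
  moreover have "D (Suc m) = 0" using total Suc by (simp add: D_def sum_subtractf)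
  ultimately have "0 \<le> (\<Sum>i<n. g i * (x i - y i))" unfolding Suc abel by simp
  then show ?thesis by (simp add: y_def algebra_simps sum_subtractf)
qed simp

lemma antimono_rearrangement:
  fixes x :: "nat \<Rightarrow> real"
  obtains p where "p permutes {..<n}" "\<And>i j. i \<le> j \<Longrightarrow> j < n \<Longrightarrow> x (p j) \<le> x (p i)"
proof -
  let ?xs = "map x [0..<n]"
  obtain p where p: "p permutes {..<n}" "permute_list p ?xs = rev (sort ?xs)"
    using mset_eq_permutation[of "rev (sort ?xs)" ?xs] by auto
  have nth: "x (p i) = rev (sort ?xs) ! i" if "i < n" for i
    using that p permute_list_nth[of p ?xs i] permutes_in_image[OF p(1)] by (auto simp flip: p(2))
  have "sorted (rev (rev (sort ?xs)))" by simp
  then have "x (p j) \<le> x (p i)" if "i \<le> j" "j < n" for i j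
    using that sorted_rev_nth_mono[of "rev (sort ?xs)" i j] by (simp add: nth)
  with p(1) show thesis by (rule that)
qed

lemma doubly_stochastic_permute:
  assumes "doubly_stochastic n S" "p permutes {..<n}" "q permutes {..<n}"
  shows "doubly_stochastic n (\<lambda>i j. S (p i) (q j))"
proof -
  have "p i < n" "q i < n" if "i < n" for i
    using that permutes_in_image[OF assms(2), of i] permutes_in_image[OF assms(3), of i] by auto
  then show ?thesis
    using assms(1) sum.permute[OF assms(2), of "\<lambda>i. S i (q j)" for j, symmetric]
      sum.permute[OF assms(3), of "\<lambda>j. S (p i) j" for i, symmetric]
    by (auto simp: doubly_stochastic_def comp_def)
qed

text \<open>Sorting rows by \<open>g\<close> and columns by \<open>x\<close> reduces to the monotone
  case. The permutation found pairs large weights with large entries, and its construction uses only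
  \<open>g\<close> and \<open>x\<close>.\<close>

lemma sum_doubly_stochastic_le_permutation:
  fixes g x :: "nat \<Rightarrow> real"
  assumes S: "doubly_stochastic n S"
  obtains p where "p permutes {..<n}"
    "(\<Sum>i<n. g i * (\<Sum>j<n. S i j * x j)) \<le> (\<Sum>i<n. g i * x (p i))"
proof -
  obtain p where p: "p permutes {..<n}" "\<And>i j. i \<le> j \<Longrightarrow> j < n \<Longrightarrow> g (p j) \<le> g (p i)"
    using antimono_rearrangement[of n g] by blast
  obtain q where q: "q permutes {..<n}" "\<And>i j. i \<le> j \<Longrightarrow> j < n \<Longrightarrow> x (q j) \<le> x (q i)"
    using antimono_rearrangement[of n x] by blast
  have "(\<Sum>i<n. g i * (\<Sum>j<n. S i j * x j)) = (\<Sum>i<n. g (p i) * (\<Sum>j<n. S (p i) (q j) * x (q j)))"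
    using sum.permute[OF p(1), of "\<lambda>i. g i * (\<Sum>j<n. S i j * x j)"]
      sum.permute[OF q(1), of "\<lambda>j. S i j * x j" for i] by (simp add: comp_def)
  also have "\<dots> \<le> (\<Sum>i<n. g (p i) * x (q i))"
    by (rule sum_doubly_stochastic_le[OF doubly_stochastic_permute[OF S p(1) q(1)]])
      (use p(2) q(2) in auto)
  also have "\<dots> = (\<Sum>i<n. g i * x (q (Hilbert_Choice.inv p i)))"
    using sum.permute[OF p(1), of "\<lambda>i. g i * x (q (Hilbert_Choice.inv p i))"]
    by (simp add: comp_def permutes_inverses[OF p(1)])
  finally show thesis
    using that[of "q \<circ> Hilbert_Choice.inv p"] permutes_compose[OF permutes_inv[OF p(1)] q(1)] by simp
qed

section \<open>Convexity of powers\<close>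

text \<open>Includes the endpoint 0, since absolute values may vanish; there the inequality reduces
  to \<open>s powr d \<le> s\<close> for s in (0, 1).\<close>

lemma powr_convex_nonneg:
  assumes "d \<ge> (1::real)"
  shows "convex_on {0..} (\<lambda>x. x powr d)"
proof (rule convex_onI)
  fix t x y :: real assume t: "0 < t" "t < 1" and xy: "x \<in> {0..}" "y \<in> {0..}"
  have le: "s powr d \<le> s" if "0 < s" "s < 1" for s :: real
    using that assms powr_mono'[of 1 d s] by simp
  consider "x = 0" | "y = 0" | "x > 0" "y > 0" using xy by fastforce
  then show "((1 - t) *\<^sub>R x + t *\<^sub>R y) powr d \<le> (1 - t) * x powr d + t * y powr d"
  proof cases
    case 1
    then show ?thesis using t xy le[of t] by (auto simp: powr_mult intro: mult_right_mono)
  next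
    case 2
    then show ?thesis using t xy le[of "1 - t"] by (auto simp: powr_mult intro: mult_right_mono)
  next
    case 3
    then show ?thesis using convex_onD[OF powr_convex[OF assms], of t x y] t by simp
  qed
qed simp

text \<open>The left quotient is dominated by the convex combination of the two right quotients with
  weights s/(s + t) and t/(s + t). This is the pointwise form of Minkowski's inequality when s and t
  are close to the two norms.\<close>

lemma abs_powr_add_le:
  fixes a b s t d :: real
  assumes d: "d \<ge> 1" and st: "s > 0" "t > 0"
  shows "(\<bar>a + b\<bar> / (s + t)) powr d \<le> s / (s + t) * (\<bar>a\<bar> / s) powr d + t / (s + t) * (\<bar>b\<bar> / t) powr d"
proof -
  let ?u = "t / (s + t)"
  have u: "0 \<le> ?u" "?u \<le> 1" "1 - ?u = s / (s + t)" using st by (auto simp: field_simps)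
  have "(\<bar>a + b\<bar> / (s + t)) powr d \<le> ((\<bar>a\<bar> + \<bar>b\<bar>) / (s + t)) powr d"
    using st d by (intro powr_mono2 divide_right_mono) auto
  also have "(\<bar>a\<bar> + \<bar>b\<bar>) / (s + t) = (1 - ?u) * (\<bar>a\<bar> / s) + ?u * (\<bar>b\<bar> / t)"
    unfolding u(3) using st by (simp add: add_divide_distrib)
  also have "\<dots> powr d \<le> (1 - ?u) * (\<bar>a\<bar> / s) powr d + ?u * (\<bar>b\<bar> / t) powr d"
    using convex_onD[OF powr_convex_nonneg[OF d], of ?u "\<bar>a\<bar> / s" "\<bar>b\<bar> / t"] u st by simp
  finally show ?thesis unfolding u(3) .
qed

text \<open>The tangent line of a convex function lies below its graph. At \<open>y = 0\<close> the
  convention \<open>sgn 0 = 0\<close> selects slope 0, a valid subgradient even at the kink for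
  \<open>d = 1\<close>.\<close>

lemma abs_powr_subgradient:
  fixes y z d :: real
  assumes d: "d \<ge> 1"
  shows "\<bar>y\<bar> powr d + d * (sgn y * \<bar>y\<bar> powr (d - 1)) * (z - y) \<le> \<bar>z\<bar> powr d"
proof (cases "y = 0")
  case False
  have *: "a powr d + d * a powr (d - 1) * (b - a) \<le> b powr d" if a: "a > 0" and b: "b \<ge> 0" for a b :: real
  proof -
    have "((\<lambda>x. x powr d) has_real_derivative d * a powr (d - 1)) (at a within {0..})"
      using a by (auto intro!: derivative_eq_intros)
    \<comment> \<open>The tangent bound needs \<open>a\<close> in the interior of the half-line;
      \<open>-1\<close> is just a point below its endpoint, as \<open>interior_Ici\<close>
      requires.\<close>
    then have "b powr d - a powr d \<ge> d * a powr (d - 1) * (b - a)"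
      using a b by (intro convex_on_imp_above_tangent[OF powr_convex_nonneg[OF d]]) (auto simp: interior_Ici[of "-1"])
    then show ?thesis by simp
  qed
  \<comment> \<open>Passing to absolute values only increases the linear term, which leaves the
    tangent inequality on the half-line.\<close>
  have "sgn y * (z - y) \<le> \<bar>z\<bar> - \<bar>y\<bar>" using False by (auto simp: sgn_if abs_if)
  then have "d * \<bar>y\<bar> powr (d - 1) * (sgn y * (z - y)) \<le> d * \<bar>y\<bar> powr (d - 1) * (\<bar>z\<bar> - \<bar>y\<bar>)"
    using d by (intro mult_left_mono) auto
  with *[of "\<bar>y\<bar>" "\<bar>z\<bar>"] False show ?thesis by (simp add: algebra_simps)
qed simp

section \<open>Moments of random variables\<close>

text \<open>A sum is at most \<open>n\<close> times its largest term, whose power is one of the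
  summands on the right. The constant is crude, but the bound only serves integrability.\<close>

lemma abs_sum_powr_le:
  fixes a :: "nat \<Rightarrow> real"
  assumes "d \<ge> 0"
  shows "\<bar>\<Sum>i<n. a i\<bar> powr d \<le> real n powr d * (\<Sum>i<n. \<bar>a i\<bar> powr d)"
proof (cases "n = 0")
  case False
  define m where "m = Max ((\<lambda>i. \<bar>a i\<bar>) ` {..<n})"
  have "m \<in> (\<lambda>i. \<bar>a i\<bar>) ` {..<n}" unfolding m_def using False by (intro Max_in) auto
  then obtain k where k: "k < n" "m = \<bar>a k\<bar>" by auto
  have "\<bar>a i\<bar> \<le> m" if "i < n" for i using that by (auto simp: m_def intro!: Max_ge)
  then have "(\<Sum>i<n. \<bar>a i\<bar>) \<le> real n * m" using sum_bounded_above[of "{..<n}" "\<lambda>i. \<bar>a i\<bar>" m] by auto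
  then have "\<bar>\<Sum>i<n. a i\<bar> \<le> real n * m" using sum_abs[of a "{..<n}"] by linarith
  then have "\<bar>\<Sum>i<n. a i\<bar> powr d \<le> (real n * m) powr d" using assms by (intro powr_mono2) auto
  also have "\<dots> = real n powr d * \<bar>a k\<bar> powr d" using k by (simp add: powr_mult)
  also have "\<dots> \<le> real n powr d * (\<Sum>i<n. \<bar>a i\<bar> powr d)"
    using k by (intro mult_left_mono member_le_sum) auto
  finally show ?thesis .
qed simp

text \<open>A Young-type bound without sharp constants: replace the smaller of \<open>a\<close> and
  \<open>b\<close> by the larger. It makes the subgradient times an entry of X integrable.\<close>

lemma powr_mult_le_add:
  fixes a b d :: real
  assumes "d \<ge> 1" "a \<ge> 0" "b \<ge> 0"
  shows "a powr (d - 1) * b \<le> a powr d + b powr d"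
proof -
  have split: "x powr (d - 1) * x = x powr d" if "x \<ge> 0" for x :: real
    using that by (cases "x = 0") (auto simp: powr_diff)
  show ?thesis
  proof (cases "b \<le> a")
    case True
    then have "a powr (d - 1) * b \<le> a powr (d - 1) * a" by (intro mult_left_mono) auto
    then show ?thesis using split[of a] assms by (simp add: add_increasing2)
  next
    case False
    then have "a powr (d - 1) * b \<le> b powr (d - 1) * b"
      using assms by (intro mult_right_mono powr_mono2) auto
    then show ?thesis using split[of b] assms by (simp add: add_increasing)
  qed
qed

text \<open>\<open>Y\<close> may have no moments, so it is replaced by \<open>arctan\<close> of it,
  which is bounded. Independence and almost sure equality turn the second moment into the square of
  the mean; the variance is 0, and injectivity of \<open>arctan\<close> carries constancy back to
  \<open>Y\<close>.\<close>

lemma (in prob_space) AE_const_of_indep_self: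
  fixes Y Z :: "'a \<Rightarrow> real"
  assumes ind: "indep_var borel Y borel Z" and eq: "AE \<omega> in M. Y \<omega> = Z \<omega>"
  shows "\<exists>c. AE \<omega> in M. Y \<omega> = c"
proof -
  have [measurable]: "Y \<in> borel_measurable M" "Z \<in> borel_measurable M"
    using indep_var_rv1[OF ind] indep_var_rv2[OF ind] by auto
  have [measurable]: "arctan \<in> borel_measurable borel"
    by (intro borel_measurable_continuous_onI continuous_on_arctan continuous_on_id)
  have bound: "norm (arctan x) \<le> 2" for x
    using arctan_lbound[of x] arctan_ubound[of x] pi_half_less_two by auto
  let ?h = "\<lambda>\<omega>. arctan (Y \<omega>)" and ?k = "\<lambda>\<omega>. arctan (Z \<omega>)"
  have bound2: "(arctan x)\<^sup>2 \<le> 4" for x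
    using power_mono[OF bound[of x], of 2] by simp
  have int: "integrable M ?h" "integrable M ?k"
    by (rule integrable_const_bound[where B = 2]; use bound in simp)+
  have int2: "integrable M (\<lambda>\<omega>. (?h \<omega>)\<^sup>2)"
    by (rule integrable_const_bound[where B = 4]) (use bound2 in auto)
  have ind': "indep_var borel ?h borel ?k"
    using indep_var_compose[OF ind, of arctan borel arctan borel] by (simp add: comp_def)
  have "expectation (\<lambda>\<omega>. (?h \<omega>)\<^sup>2) = expectation (\<lambda>\<omega>. ?h \<omega> * ?k \<omega>)"
    using eq by (intro integral_cong_AE) (auto simp: power2_eq_square)
  also have "\<dots> = expectation ?h * expectation ?k"
    by (rule indep_var_lebesgue_integral[OF ind' int])
  also have "expectation ?k = expectation ?h"
    using eq by (intro integral_cong_AE) auto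
  finally have "variance ?h = 0"
    using variance_eq[OF int(1) int2] by (simp add: power2_eq_square)
  moreover have "integrable M (\<lambda>\<omega>. (?h \<omega> - expectation ?h)\<^sup>2)"
    using int(1) int2 by (simp add: power2_diff)
  ultimately have "AE \<omega> in M. (?h \<omega> - expectation ?h)\<^sup>2 = 0"
    by (subst (asm) integral_nonneg_eq_0_iff_AE) auto
  then have "AE \<omega> in M. Y \<omega> = tan (expectation ?h)"
    by eventually_elim (metis power_eq_0_iff right_minus_eq tan_arctan)
  then show ?thesis by blast
qed

lemma integrable_abs_add_powr:
  fixes Y Z :: "'a \<Rightarrow> real"
  assumes [measurable]: "Y \<in> borel_measurable M" "Z \<in> borel_measurable M"
    and d: "d \<ge> 1"
    and Y: "integrable M (\<lambda>\<omega>. \<bar>Y \<omega>\<bar> powr d)" and Z: "integrable M (\<lambda>\<omega>. \<bar>Z \<omega>\<bar> powr d)"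
  shows "integrable M (\<lambda>\<omega>. \<bar>Y \<omega> + Z \<omega>\<bar> powr d)"
proof (rule Bochner_Integration.integrable_bound)
  show "integrable M (\<lambda>\<omega>. 2 powr d * (\<bar>Y \<omega>\<bar> powr d + \<bar>Z \<omega>\<bar> powr d))" using Y Z by simp
  show "AE \<omega> in M. norm (\<bar>Y \<omega> + Z \<omega>\<bar> powr d) \<le> norm (2 powr d * (\<bar>Y \<omega>\<bar> powr d + \<bar>Z \<omega>\<bar> powr d))"
    using abs_sum_powr_le[of d "\<lambda>i. if i = 0 then Y \<omega> else Z \<omega>" 2 for \<omega>] d
    by (auto simp: numeral_2_eq_2)
qed simp

text \<open>Scaled by numbers just above their norms, both functions have d-th moment at most 1,
  hence so does their convex combination.\<close>

lemma minkowski_powr: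
  fixes Y Z :: "'a \<Rightarrow> real"
  assumes [measurable]: "Y \<in> borel_measurable M" "Z \<in> borel_measurable M"
    and d: "d \<ge> 1"
    and Y: "integrable M (\<lambda>\<omega>. \<bar>Y \<omega>\<bar> powr d)" and Z: "integrable M (\<lambda>\<omega>. \<bar>Z \<omega>\<bar> powr d)"
  shows "(\<integral>\<omega>. \<bar>Y \<omega> + Z \<omega>\<bar> powr d \<partial>M) powr (1 / d)
    \<le> (\<integral>\<omega>. \<bar>Y \<omega>\<bar> powr d \<partial>M) powr (1 / d) + (\<integral>\<omega>. \<bar>Z \<omega>\<bar> powr d \<partial>M) powr (1 / d)"
proof (rule field_le_epsilon)
  fix \<epsilon> :: real assume \<epsilon>: "\<epsilon> > 0"
  \<comment> \<open>The summand \<open>\<epsilon> / 2\<close> keeps \<open>s\<close> and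
    \<open>t\<close> positive even when a norm vanishes, so that division is safe.\<close>
  define s where "s = (\<integral>\<omega>. \<bar>Y \<omega>\<bar> powr d \<partial>M) powr (1 / d) + \<epsilon> / 2"
  define t where "t = (\<integral>\<omega>. \<bar>Z \<omega>\<bar> powr d \<partial>M) powr (1 / d) + \<epsilon> / 2"
  have st: "s > 0" "t > 0" using \<epsilon> by (auto simp: s_def t_def add_nonneg_pos)
  have unit: "(\<integral>\<omega>. (\<bar>W \<omega>\<bar> / r) powr d \<partial>M) \<le> 1"
    if "r > 0" "(\<integral>\<omega>. \<bar>W \<omega>\<bar> powr d \<partial>M) powr (1 / d) \<le> r" for W :: "'a \<Rightarrow> real" and r
  proof -
    have "((\<integral>\<omega>. \<bar>W \<omega>\<bar> powr d \<partial>M) powr (1 / d)) powr d \<le> r powr d"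
      using that d by (intro powr_mono2) auto
    then have "(\<integral>\<omega>. \<bar>W \<omega>\<bar> powr d \<partial>M) \<le> r powr d" using d by (simp add: powr_powr)
    then show ?thesis using that by (simp add: powr_divide)
  qed
  have intd: "integrable M (\<lambda>\<omega>. (\<bar>W \<omega>\<bar> / r) powr d)"
    if "r > 0" "integrable M (\<lambda>\<omega>. \<bar>W \<omega>\<bar> powr d)" for W :: "'a \<Rightarrow> real" and r
    using that by (simp add: powr_divide)
  note intYZ = integrable_abs_add_powr[OF assms]
  have "(\<integral>\<omega>. (\<bar>Y \<omega> + Z \<omega>\<bar> / (s + t)) powr d \<partial>M)
      \<le> (\<integral>\<omega>. s / (s + t) * (\<bar>Y \<omega>\<bar> / s) powr d + t / (s + t) * (\<bar>Z \<omega>\<bar> / t) powr d \<partial>M)"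
    using intd[OF _ intYZ, of "s + t"] intd[OF st(1) Y] intd[OF st(2) Z] st abs_powr_add_le[OF d st]
    by (intro integral_mono) auto
  also have "\<dots> = s / (s + t) * (\<integral>\<omega>. (\<bar>Y \<omega>\<bar> / s) powr d \<partial>M) + t / (s + t) * (\<integral>\<omega>. (\<bar>Z \<omega>\<bar> / t) powr d \<partial>M)"
    using intd[OF st(1) Y] intd[OF st(2) Z] by simp
  also have "\<dots> \<le> s / (s + t) * 1 + t / (s + t) * 1"
    using st \<epsilon> unit[of s Y] unit[of t Z] by (intro add_mono mult_left_mono) (auto simp: s_def t_def)
  also have "\<dots> = 1" using st by (simp add: add_divide_distrib[symmetric])
  finally have "(\<integral>\<omega>. \<bar>Y \<omega> + Z \<omega>\<bar> powr d \<partial>M) \<le> (s + t) powr d"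
    using st by (simp add: powr_divide)
  then have "(\<integral>\<omega>. \<bar>Y \<omega> + Z \<omega>\<bar> powr d \<partial>M) powr (1 / d) \<le> ((s + t) powr d) powr (1 / d)"
    using d by (intro powr_mono2) auto
  also have "\<dots> = s + t" using st d by (simp add: powr_powr)
  finally show "(\<integral>\<omega>. \<bar>Y \<omega> + Z \<omega>\<bar> powr d \<partial>M) powr (1 / d)
    \<le> (\<integral>\<omega>. \<bar>Y \<omega>\<bar> powr d \<partial>M) powr (1 / d) + (\<integral>\<omega>. \<bar>Z \<omega>\<bar> powr d \<partial>M) powr (1 / d) + \<epsilon>"
    by (simp add: s_def t_def)
qed

section \<open>Dependence of moments on the exponent\<close>

text \<open>One majorant for all exponents up to \<open>m\<close>: it yields integrability of lower
  moments and the domination needed for continuity in the exponent.\<close>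

lemma abs_powr_le_1_add:
  fixes y d m :: real
  assumes "0 \<le> d" "d \<le> m"
  shows "\<bar>y\<bar> powr d \<le> 1 + \<bar>y\<bar> powr m"
proof (cases "\<bar>y\<bar> \<le> 1")
  case True
  then have "\<bar>y\<bar> powr d \<le> 1" using assms by (simp add: powr_le1)
  then show ?thesis by (simp add: add_increasing2)
next
  case False
  then have "\<bar>y\<bar> powr d \<le> \<bar>y\<bar> powr m" using assms by (intro powr_mono) auto
  then show ?thesis by simp
qed

lemma (in prob_space) integrable_abs_powr_mono:
  fixes Y :: "'a \<Rightarrow> real"
  assumes [measurable]: "Y \<in> borel_measurable M"
    and int: "integrable M (\<lambda>\<omega>. \<bar>Y \<omega>\<bar> powr m)" and d: "0 \<le> d" "d \<le> m"
  shows "integrable M (\<lambda>\<omega>. \<bar>Y \<omega>\<bar> powr d)"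
proof (rule Bochner_Integration.integrable_bound)
  show "integrable M (\<lambda>\<omega>. 1 + \<bar>Y \<omega>\<bar> powr m)" using int by simp
qed (use abs_powr_le_1_add[OF d] in auto)

lemma (in prob_space) continuous_on_moment:
  fixes Y :: "'a \<Rightarrow> real"
  assumes [measurable]: "Y \<in> borel_measurable M"
    and int: "integrable M (\<lambda>\<omega>. \<bar>Y \<omega>\<bar> powr m)"
  shows "continuous_on {0..m} (\<lambda>d. \<integral>\<omega>. \<bar>Y \<omega>\<bar> powr d \<partial>M)"
proof (rule continuous_on_sequentiallyI)
  fix u :: "nat \<Rightarrow> real" and a assume u: "\<forall>n. u n \<in> {0..m}" "u \<longlonglongrightarrow> a"
  show "(\<lambda>n. \<integral>\<omega>. \<bar>Y \<omega>\<bar> powr u n \<partial>M) \<longlonglongrightarrow> (\<integral>\<omega>. \<bar>Y \<omega>\<bar> powr a \<partial>M)"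
  proof (rule integral_dominated_convergence[where w = "\<lambda>\<omega>. 1 + \<bar>Y \<omega>\<bar> powr m"])
    \<comment> \<open>Where \<open>Y\<close> vanishes the sequence is constantly 0, and so is its
      limit, because \<open>0 powr 0 = 0\<close>; thus exponent 0 causes no jump.\<close>
    have "(\<lambda>n. \<bar>Y \<omega>\<bar> powr u n) \<longlonglongrightarrow> \<bar>Y \<omega>\<bar> powr a" for \<omega>
      using u(2) by (cases "Y \<omega> = 0") (auto intro!: tendsto_intros)
    then show "AE \<omega> in M. (\<lambda>n. \<bar>Y \<omega>\<bar> powr u n) \<longlonglongrightarrow> \<bar>Y \<omega>\<bar> powr a" by simp
    show "AE \<omega> in M. norm (\<bar>Y \<omega>\<bar> powr u n) \<le> 1 + \<bar>Y \<omega>\<bar> powr m" for n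
      using u(1) abs_powr_le_1_add[of "u n" m] by auto
  qed (use int in auto)
qed

text \<open>Continuity of \<open>powr\<close> in base and exponent jointly is invoked at a nonzero
  base. If \<open>Y\<close> vanishes almost surely the function is constantly 0; otherwise no moment
  vanishes and the quotient stays away from 0.\<close>

lemma (in prob_space) continuous_on_moment_root:
  fixes Y :: "'a \<Rightarrow> real"
  assumes Y: "Y \<in> borel_measurable M" and int: "integrable M (\<lambda>\<omega>. \<bar>Y \<omega>\<bar> powr m)"
  shows "continuous_on {1..m} (\<lambda>d. ((\<integral>\<omega>. \<bar>Y \<omega>\<bar> powr d \<partial>M) / Gamma (d + 1)) powr (1 / d))"
proof (cases "AE \<omega> in M. Y \<omega> = 0")
  case True
  have "(\<integral>\<omega>. \<bar>Y \<omega>\<bar> powr d \<partial>M) = 0" for d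
    by (rule integral_eq_zero_AE) (use True in eventually_elim, simp)
  then show ?thesis by simp
next
  case False
  have "(\<integral>\<omega>. \<bar>Y \<omega>\<bar> powr d \<partial>M) \<noteq> 0" if "d \<in> {1..m}" for d
  proof
    assume "(\<integral>\<omega>. \<bar>Y \<omega>\<bar> powr d \<partial>M) = 0"
    moreover have "integrable M (\<lambda>\<omega>. \<bar>Y \<omega>\<bar> powr d)"
      using integrable_abs_powr_mono[OF Y int, of d] that by auto
    ultimately have "AE \<omega> in M. \<bar>Y \<omega>\<bar> powr d = 0"
      by (subst (asm) integral_nonneg_eq_0_iff_AE) auto
    then have "AE \<omega> in M. Y \<omega> = 0" by simp
    with False show False by blast
  qed
  moreover have "Gamma (d + 1) \<noteq> 0" if "d \<in> {1..m}" for d :: real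
    using that by (intro order.strict_implies_not_eq[OF Gamma_real_pos, symmetric]) auto
  moreover have "continuous_on {1..m} (\<lambda>d. \<integral>\<omega>. \<bar>Y \<omega>\<bar> powr d \<partial>M)"
    by (rule continuous_on_subset[OF continuous_on_moment[OF Y int]]) auto
  moreover have "continuous_on {1..m} (\<lambda>d::real. Gamma (d + 1))"
    by (rule continuous_on_compose2[OF continuous_on_Gamma[of "{0<..}"]])
      (auto dest: nonpos_Ints_nonpos intro!: continuous_intros)
  ultimately show ?thesis by (intro continuous_intros) auto
qed

section \<open>Linear forms in iid random vectors\<close>

locale iid_vector = prob_space M for M :: "'a measure" +
  fixes n :: nat and X :: "nat \<Rightarrow> 'a \<Rightarrow> real"
  assumes iid: "iid_random_vector M n X"
begin

definition lin :: "(nat \<Rightarrow> real) \<Rightarrow> 'a \<Rightarrow> real" where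
  "lin v \<omega> = (\<Sum>i<n. X i \<omega> * v i)"

text \<open>The d-th power of the norm without its Gamma factor, on arbitrary coordinate vectors
  instead of sorted spectra; symmetry and convexity are properties of this function.\<close>

definition moment :: "real \<Rightarrow> (nat \<Rightarrow> real) \<Rightarrow> real" where
  "moment d v = expectation (\<lambda>\<omega>. \<bar>lin v \<omega>\<bar> powr d)"

lemma measurable_X [measurable]: "i < n \<Longrightarrow> X i \<in> borel_measurable M"
  using iid by (simp add: iid_random_vector_def)

lemma measurable_lin [measurable]: "lin v \<in> borel_measurable M"
  unfolding lin_def by measurable

lemma indep_X: "indep_vars (\<lambda>_. borel) X {..<n}"
  using iid by (simp add: iid_random_vector_def)

lemma distr_X: "i < n \<Longrightarrow> distr M borel (X i) = distr M borel (X 0)"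
  using iid unfolding iid_random_vector_def by blast

lemma lin_cong: "(\<And>i. i < n \<Longrightarrow> v i = w i) \<Longrightarrow> lin v = lin w"
  unfolding lin_def by (intro ext sum.cong) auto

lemma moment_cong: "(\<And>i. i < n \<Longrightarrow> v i = w i) \<Longrightarrow> moment d v = moment d w"
  unfolding moment_def using lin_cong by metis

lemma moment_nonneg: "0 \<le> moment d v"
  by (simp add: moment_def)

lemma integrable_X_powr:
  assumes "integrable M (\<lambda>\<omega>. \<bar>X 0 \<omega>\<bar> powr d)" "i < n"
  shows "integrable M (\<lambda>\<omega>. \<bar>X i \<omega>\<bar> powr d)"
proof -
  have "integrable (distr M borel (X 0)) (\<lambda>x. \<bar>x\<bar> powr d)"
    using assms by (subst integrable_distr_eq) auto
  then have "integrable (distr M borel (X i)) (\<lambda>x. \<bar>x\<bar> powr d)"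
    by (simp only: distr_X[OF assms(2)])
  then show ?thesis using assms by (subst (asm) integrable_distr_eq) auto
qed

lemma integrable_lin_powr:
  assumes int: "integrable M (\<lambda>\<omega>. \<bar>X 0 \<omega>\<bar> powr d)" and d: "d \<ge> 0"
  shows "integrable M (\<lambda>\<omega>. \<bar>lin v \<omega>\<bar> powr d)"
proof (rule Bochner_Integration.integrable_bound)
  show "integrable M (\<lambda>\<omega>. real n powr d * (\<Sum>i<n. \<bar>X i \<omega> * v i\<bar> powr d))"
    using integrable_X_powr[OF int]
    by (auto simp: abs_mult powr_mult intro!: Bochner_Integration.integrable_sum)
  show "AE \<omega> in M. norm (\<bar>lin v \<omega>\<bar> powr d) \<le> norm (real n powr d * (\<Sum>i<n. \<bar>X i \<omega> * v i\<bar> powr d))"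
    using abs_sum_powr_le[OF d, of "\<lambda>i. X i \<omega> * v i" n for \<omega>]
    by (auto simp: lin_def intro!: order_trans[OF _ abs_ge_self])
qed simp

text \<open>Independence and equal marginals make the joint law a power of a single distribution,
  which is preserved by permuting coordinates. For \<open>n = 0\<close> there is nothing to permute,
  and \<open>X 0\<close> is not known to be measurable.\<close>

lemma moment_permute:
  assumes p: "p permutes {..<n}"
  shows "moment d (\<lambda>i. v (p i)) = moment d v"
proof (cases "n = 0")
  case False
  let ?I = "{..<n}"
  let ?q = "Hilbert_Choice.inv p"
  let ?P = "PiM ?I (\<lambda>_. distr M borel (X 0))"
  have q: "?q permutes ?I" using p by (rule permutes_inv)
  have joint: "distr M (PiM ?I (\<lambda>_. borel)) (\<lambda>\<omega>. \<lambda>i\<in>?I. X i \<omega>) = ?P"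
  proof -
    have "PiM ?I (\<lambda>i. distr M borel (X i)) = ?P" by (rule PiM_cong) (simp, rule distr_X, simp)
    then show ?thesis
      using indep_X indep_vars_iff_distr_eq_PiM'[of ?I X "\<lambda>_. borel"] False by auto
  qed
  define H where "H w f = \<bar>\<Sum>i<n. f i * w i\<bar> powr d" for w f :: "nat \<Rightarrow> real"
  have H [measurable]: "H w \<in> borel_measurable (PiM ?I (\<lambda>_. borel))" for w
    unfolding H_def by measurable
  have sets: "sets ?P = sets (PiM ?I (\<lambda>_. borel))" by (intro sets_PiM_cong) auto
  have moment: "moment d w = (\<integral>f. H w f \<partial>?P)" for w
    unfolding joint[symmetric]
    by (subst integral_distr) (simp_all add: moment_def lin_def H_def)
  have 0: "prob_space (distr M borel (X 0))" using False by (intro prob_space_distr) auto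
  have reindex: "distr ?P ?P (\<lambda>f. \<lambda>i\<in>?I. f (?q i)) = ?P"
    using distr_PiM_reindex[of ?I "\<lambda>_. distr M borel (X 0)" ?q ?I] 0 permutes_inj_on[OF q]
      permutes_in_image[OF q] by auto
  have "(\<integral>f. H v f \<partial>?P) = (\<integral>f. H v f \<partial>(distr ?P ?P (\<lambda>f. \<lambda>i\<in>?I. f (?q i))))"
    by (simp only: reindex)
  also have "\<dots> = (\<integral>f. H v (\<lambda>i\<in>?I. f (?q i)) \<partial>?P)"
  proof (rule integral_distr)
    show "H v \<in> borel_measurable ?P" using H measurable_cong_sets[OF sets refl] by blast
    show "(\<lambda>f. \<lambda>i\<in>?I. f (?q i)) \<in> measurable ?P ?P"
      using permutes_in_image[OF q] by (intro measurable_restrict measurable_component_singleton) auto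
  qed
  also have "\<dots> = (\<integral>f. H (\<lambda>i. v (p i)) f \<partial>?P)"
  proof -
    \<comment> \<open>Moving the coordinates of \<open>f\<close> by the inverse of \<open>p\<close>
      amounts to moving those of \<open>v\<close> by \<open>p\<close>, after renaming the summation
      index.\<close>
    have "H v (\<lambda>i\<in>?I. f (?q i)) = H (\<lambda>i. v (p i)) f" for f
      unfolding H_def
      using sum.permute[OF p, of "\<lambda>i. f (?q i) * v i"] by (simp add: permutes_inverses[OF p] comp_def)
    then show ?thesis by simp
  qed
  finally show ?thesis by (simp add: moment)
qed (rule moment_cong, simp)

text \<open>This is where the sorted order of the spectrum is forgotten: any enumeration gives the
  same moment.\<close>

lemma moment_mset_cong:
  assumes "mset xs = mset ys" "length ys = n"
  shows "moment d (\<lambda>i. xs ! i) = moment d (\<lambda>i. ys ! i)"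
proof -
  obtain p where p: "p permutes {..<length ys}" "permute_list p ys = xs"
    using mset_eq_permutation[OF assms(1)] .
  have "moment d (\<lambda>i. xs ! i) = moment d (\<lambda>i. ys ! p i)"
    using p assms(2) by (intro moment_cong) (auto simp flip: p(2) simp: permute_list_nth)
  also have "\<dots> = moment d (\<lambda>i. ys ! i)"
    using moment_permute[of p d "\<lambda>i. ys ! i"] p assms(2) by simp
  finally show ?thesis .
qed

lemma moment_smult: "moment d (\<lambda>i. c * v i) = \<bar>c\<bar> powr d * moment d v"
proof -
  have "lin (\<lambda>i. c * v i) \<omega> = c * lin v \<omega>" for \<omega>
    by (simp add: lin_def sum_distrib_left algebra_simps)
  then show ?thesis by (simp add: moment_def abs_mult powr_mult)
qed

lemma moment_eq_0_iff:
  assumes int: "integrable M (\<lambda>\<omega>. \<bar>X 0 \<omega>\<bar> powr d)" and d: "d \<ge> 0"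
  shows "moment d v = 0 \<longleftrightarrow> (\<forall>i<n. v i = 0)"
proof
  assume "moment d v = 0"
  then have "AE \<omega> in M. \<bar>lin v \<omega>\<bar> powr d = 0"
    unfolding moment_def using integrable_lin_powr[OF int d]
    by (subst (asm) integral_nonneg_eq_0_iff_AE) auto
  \<comment> \<open>In HOL \<open>x powr d = 0\<close> holds exactly when \<open>x = 0\<close>, also
    for \<open>d = 0\<close>.\<close>
  then have zero: "AE \<omega> in M. lin v \<omega> = 0" by simp
  show "\<forall>i<n. v i = 0"
  proof (intro allI impI, rule ccontr)
    fix k assume k: "k < n" "v k \<noteq> 0"
    let ?Y = "\<lambda>i \<omega>. X i \<omega> * v i"
    let ?J = "{..<n} - {k}"
    have "indep_vars (\<lambda>_. borel) ?Y (insert k ?J)"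
      using indep_vars_compose2[OF indep_X, of "\<lambda>i x. x * v i" "\<lambda>_. borel"] k by (simp add: insert_absorb)
    then have "indep_var borel (?Y k) borel (\<lambda>\<omega>. \<Sum>i\<in>?J. ?Y i \<omega>)"
      by (intro indep_vars_sum) auto
    \<comment> \<open>The sign is flipped so that the second variable agrees almost surely with
      \<open>?Y k\<close>, as solving \<open>lin v = 0\<close> for that term shows.\<close>
    then have "indep_var borel (?Y k) borel (\<lambda>\<omega>. - (\<Sum>i\<in>?J. ?Y i \<omega>))"
      using indep_var_compose[of borel "?Y k" borel _ id borel uminus borel] by (simp add: comp_def)
    moreover have "AE \<omega> in M. ?Y k \<omega> = - (\<Sum>i\<in>?J. ?Y i \<omega>)"
      using zero
    proof eventually_elim
      case (elim \<omega>)
      then show ?case using k sum.remove[of "{..<n}" k "\<lambda>i. ?Y i \<omega>"] by (simp add: lin_def)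
    qed
    ultimately obtain c where "AE \<omega> in M. ?Y k \<omega> = c"
      using AE_const_of_indep_self by blast
    then have "AE \<omega> in M. X k \<omega> = c / v k"
      by eventually_elim (use k in \<open>auto simp: field_simps\<close>)
    with k iid show False by (auto simp: iid_random_vector_def)
  qed
next
  assume "\<forall>i<n. v i = 0"
  then show "moment d v = 0" using moment_cong[of v "\<lambda>_. 0"] by (simp add: moment_def lin_def)
qed

text \<open>Linearizing \<open>y \<mapsto> \<bar>y\<bar>\<^sup>d\<close> at \<open>lin (S x)\<close> turns the claim into the maximization of a
  linear functional over doubly stochastic matrices, where some permutation matrix is at least as
  good as \<open>S\<close>; so Birkhoff's theorem is not needed.\<close>

lemma moment_doubly_stochastic_le:
  assumes int: "integrable M (\<lambda>\<omega>. \<bar>X 0 \<omega>\<bar> powr d)" and d: "d \<ge> 1" and S: "doubly_stochastic n S"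
  shows "moment d (\<lambda>i. \<Sum>j<n. S i j * x j) \<le> moment d x"
proof -
  let ?y = "\<lambda>i. \<Sum>j<n. S i j * x j"
  \<comment> \<open>The subgradient of the d-th power of the absolute value at
    \<open>lin ?y\<close>, without the factor \<open>d\<close>; its correlations \<open>g i\<close>
    with the entries of X are the coefficients of the linear functional.\<close>
  define s where "s \<omega> = sgn (lin ?y \<omega>) * \<bar>lin ?y \<omega>\<bar> powr (d - 1)" for \<omega>
  have [measurable]: "s \<in> borel_measurable M" unfolding s_def by measurable
  define g where "g i = expectation (\<lambda>\<omega>. s \<omega> * X i \<omega>)" for i
  have sX: "integrable M (\<lambda>\<omega>. s \<omega> * X i \<omega>)" if i: "i < n" for i
  proof (rule Bochner_Integration.integrable_bound)
    show "integrable M (\<lambda>\<omega>. \<bar>lin ?y \<omega>\<bar> powr d + \<bar>X i \<omega>\<bar> powr d)"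
      using integrable_lin_powr[OF int] integrable_X_powr[OF int i] d by auto
    \<comment> \<open>Zeros of \<open>lin ?y\<close> are separated because \<open>s\<close> vanishes
      there; elsewhere the modulus of \<open>s\<close> is the power with exponent
      \<open>d - 1\<close>.\<close>
    have "\<bar>s \<omega> * X i \<omega>\<bar> \<le> \<bar>lin ?y \<omega>\<bar> powr d + \<bar>X i \<omega>\<bar> powr d" for \<omega>
      using powr_mult_le_add[OF d, of "\<bar>lin ?y \<omega>\<bar>" "\<bar>X i \<omega>\<bar>"]
      by (cases "lin ?y \<omega> = 0") (auto simp: s_def abs_mult)
    then show "AE \<omega> in M. norm (s \<omega> * X i \<omega>) \<le> norm (\<bar>lin ?y \<omega>\<bar> powr d + \<bar>X i \<omega>\<bar> powr d)" by auto
  qed (use i in measurable)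
  have s_lin: "s \<omega> * lin w \<omega> = (\<Sum>i<n. (s \<omega> * X i \<omega>) * w i)" for w \<omega>
    by (simp add: lin_def sum_distrib_left algebra_simps)
  have int_s_lin: "integrable M (\<lambda>\<omega>. s \<omega> * lin w \<omega>)" for w
    unfolding s_lin using sX by (intro Bochner_Integration.integrable_sum) auto
  have exp_s_lin: "expectation (\<lambda>\<omega>. s \<omega> * lin w \<omega>) = (\<Sum>i<n. g i * w i)" for w
    unfolding s_lin g_def using sX by (subst Bochner_Integration.integral_sum) auto
  obtain p where p: "p permutes {..<n}" "(\<Sum>i<n. g i * ?y i) \<le> (\<Sum>i<n. g i * x (p i))"
    using sum_doubly_stochastic_le_permutation[OF S, of g x] by blast
  let ?z = "\<lambda>i. x (p i)"
  \<comment> \<open>The added term is the linearized change from \<open>?y\<close> to the permuted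
    vector \<open>?z\<close>; it is nonnegative by the choice of \<open>p\<close>.\<close>
  have "moment d ?y \<le> moment d ?y + d * ((\<Sum>i<n. g i * ?z i) - (\<Sum>i<n. g i * ?y i))"
    using p(2) d by simp
  also have "\<dots> = expectation (\<lambda>\<omega>. \<bar>lin ?y \<omega>\<bar> powr d + d * (s \<omega> * lin ?z \<omega> - s \<omega> * lin ?y \<omega>))"
    using integrable_lin_powr[OF int] d int_s_lin exp_s_lin by (simp add: moment_def)
  also have "\<dots> \<le> moment d ?z"
    unfolding moment_def
  proof (rule integral_mono)
    show "\<bar>lin ?y \<omega>\<bar> powr d + d * (s \<omega> * lin ?z \<omega> - s \<omega> * lin ?y \<omega>) \<le> \<bar>lin ?z \<omega>\<bar> powr d" for \<omega>
      using abs_powr_subgradient[OF d, of "lin ?y \<omega>" "lin ?z \<omega>"] by (simp add: s_def algebra_simps)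
  qed (use integrable_lin_powr[OF int] d int_s_lin in auto)
  also have "\<dots> = moment d x" by (rule moment_permute[OF p(1)])
  finally show ?thesis .
qed

lemma moment_root_add:
  assumes int: "integrable M (\<lambda>\<omega>. \<bar>X 0 \<omega>\<bar> powr d)" and d: "d \<ge> 1"
  shows "moment d (\<lambda>i. v i + w i) powr (1 / d) \<le> moment d v powr (1 / d) + moment d w powr (1 / d)"
proof -
  have "lin (\<lambda>i. v i + w i) \<omega> = lin v \<omega> + lin w \<omega>" for \<omega>
    by (simp add: lin_def sum.distrib algebra_simps)
  then show ?thesis
    using minkowski_powr[of "lin v" M "lin w" d] integrable_lin_powr[OF int] d by (simp add: moment_def)
qed

section \<open>From coordinate vectors back to matrices\<close>

abbreviation spectrum_moment :: "real \<Rightarrow> complex mat \<Rightarrow> real" where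
  "spectrum_moment d A \<equiv> moment d (\<lambda>i. eigvals_desc A ! i)"

lemma spectrum_moment_eq:
  assumes "mset (eigvals_desc A) = mset (map l [0..<n])"
  shows "spectrum_moment d A = moment d l"
  using moment_mset_cong[OF assms, of d] moment_cong[of "\<lambda>i. map l [0..<n] ! i" l d] by simp

lemma rv_norm_eq:
  assumes d: "d \<ge> 1"
  shows "rv_norm M n X d A = spectrum_moment d A powr (1 / d) / Gamma (d + 1) powr (1 / d)"
proof -
  have "Gamma (d + 1) > 0" using d by (intro Gamma_real_pos) auto
  then show ?thesis
    unfolding rv_norm_def moment_def[symmetric] lin_def[symmetric]
    by (simp add: powr_divide moment_nonneg)
qed

lemma rv_norm_smult:
  assumes d: "d \<ge> 1" and A: "A \<in> hermitian_mats n"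
  shows "rv_norm M n X d (complex_of_real c \<cdot>\<^sub>m A) = \<bar>c\<bar> * rv_norm M n X d A"
proof -
  have "spectrum_moment d (complex_of_real c \<cdot>\<^sub>m A) = moment d (\<lambda>i. map ((*) c) (eigvals_desc A) ! i)"
    using eigvals_desc_smult[OF A] length_eigvals_desc[OF A] by (intro moment_mset_cong) auto
  also have "\<dots> = moment d (\<lambda>i. c * eigvals_desc A ! i)"
    using length_eigvals_desc[OF A] by (intro moment_cong) auto
  finally show ?thesis
    using d by (simp add: rv_norm_eq moment_smult powr_mult powr_powr moment_nonneg)
qed

lemma rv_norm_triangle:
  assumes int: "integrable M (\<lambda>\<omega>. \<bar>X 0 \<omega>\<bar> powr d)" and d: "d \<ge> 1"
    and A: "A \<in> hermitian_mats n" and B: "B \<in> hermitian_mats n"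
  shows "rv_norm M n X d (A + B) \<le> rv_norm M n X d A + rv_norm M n X d B"
proof -
  obtain S T a b where S: "doubly_stochastic n S" and T: "doubly_stochastic n T"
    and a: "mset (eigvals_desc A) = mset (map a [0..<n])"
    and b: "mset (eigvals_desc B) = mset (map b [0..<n])"
    and ab: "mset (eigvals_desc (A + B))
      = mset (map (\<lambda>i. (\<Sum>j<n. S i j * a j) + (\<Sum>j<n. T i j * b j)) [0..<n])"
    using eigvals_desc_add[OF A B] .
  have "spectrum_moment d (A + B) powr (1 / d)
      \<le> moment d (\<lambda>i. \<Sum>j<n. S i j * a j) powr (1 / d) + moment d (\<lambda>i. \<Sum>j<n. T i j * b j) powr (1 / d)"
    unfolding spectrum_moment_eq[OF ab] by (rule moment_root_add[OF int d])
  also have "\<dots> \<le> moment d a powr (1 / d) + moment d b powr (1 / d)"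
    using d moment_doubly_stochastic_le[OF int d]
    by (intro add_mono powr_mono2) (auto simp: moment_nonneg S T)
  finally show ?thesis
    using d by (simp add: rv_norm_eq spectrum_moment_eq[OF a] spectrum_moment_eq[OF b]
      add_divide_distrib[symmetric] divide_right_mono)
qed

lemma is_norm_rv_norm:
  assumes int: "integrable M (\<lambda>\<omega>. \<bar>X 0 \<omega>\<bar> powr d)" and d: "d \<ge> 1"
  shows "is_norm_on_hermitian n (rv_norm M n X d)"
proof -
  have "Gamma (d + 1) \<noteq> 0"
    using d by (intro order.strict_implies_not_eq[OF Gamma_real_pos, symmetric]) auto
  then have "rv_norm M n X d A = 0 \<longleftrightarrow> A = 0\<^sub>m n n" if "A \<in> hermitian_mats n" for A
    using d moment_eq_0_iff[OF int, of "\<lambda>i. eigvals_desc A ! i"] hermitian_eq_0_iff[OF that]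
    by (simp add: rv_norm_eq)
  then show ?thesis
    using rv_norm_smult[OF d] rv_norm_triangle[OF int d]
    by (simp add: is_norm_on_hermitian_def rv_norm_eq d)
qed

end

theorem theorem2:
  fixes M :: "'a measure" and X :: "nat \<Rightarrow> 'a \<Rightarrow> real" and n :: nat
  assumes "prob_space M" and "n \<ge> 1" and "iid_random_vector M n X"
  shows "(\<forall>d::real. d \<ge> 1 \<longrightarrow> integrable M (\<lambda>\<omega>. \<bar>X 0 \<omega>\<bar> powr d) \<longrightarrow>
            is_norm_on_hermitian n (rv_norm M n X d) \<and>
            weakly_unitarily_invariant n (rv_norm M n X d))
       \<and> (\<forall>m::real. m \<ge> 1 \<longrightarrow> integrable M (\<lambda>\<omega>. \<bar>X 0 \<omega>\<bar> powr m) \<longrightarrow>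
            (\<forall>A\<in>hermitian_mats n. continuous_on {1..m} (\<lambda>d. rv_norm M n X d A)))"
proof -
  interpret prob_space M by fact
  interpret iid_vector M n X by unfold_locales fact
  have "weakly_unitarily_invariant n (rv_norm M n X d)" for d
    unfolding weakly_unitarily_invariant_def rv_norm_def
    by (intro ballI allI impI) (simp only: eigvals_desc_unitary_conj[OF hermitian_mats_carrier])
  moreover have "continuous_on {1..m} (\<lambda>d. rv_norm M n X d A)"
    if "m \<ge> 1" "integrable M (\<lambda>\<omega>. \<bar>X 0 \<omega>\<bar> powr m)" for m A
    using that continuous_on_moment_root[OF measurable_lin integrable_lin_powr[OF that(2)],
        of "\<lambda>i. eigvals_desc A ! i"]
    by (simp add: rv_norm_def lin_def)
  ultimately show ?thesis using is_norm_rv_norm by blast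
qed

end
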